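(* $\mathrm{L}(\textsc{Parity}_n)=\widetilde\Theta(2^{2\sqrt n})$; more precisely, for all $n$, \[ 2^{2\sqrt n-5}\;\le\;\mathrm{L}(\textsc{Parity}_n)\;\le\;O\!\left(2^{2\sqrt n}\sqrt n\right). \]
   Context: $\textsc{Parity}_n(x)=1$ iff the number of ones in $x\in\{0,1\}^n$ is odd. A CNF formula is an AND of clauses (ORs of literals); its size is its number of clauses. A depth-3 formula is an OR of CNF formulas $\phi_1\vee\dots\vee\phi_m$, of size $\sum_i|\phi_i|$. $\mathrm{L}(f)$ is the minimum size of a depth-3 formula computing $f$. *)

theory Defs
  imports Complex_Main "HOL-Library.Landau_Symbols"
begin

text \<open>A Boolean function on \<open>{0,1}\<close>-vectors of length \<open>n\<close> is represented by its values on the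
  Boolean lists of length \<open>n\<close>; its values on other lists are ignored.  Variables are numbered
  from \<open>0\<close> to \<open>n - 1\<close>.\<close>

definition parity :: "bool list \<Rightarrow> bool" where
  "parity x \<longleftrightarrow> odd (card {i. i < length x \<and> x ! i})"

datatype literal = Pos (var: nat) | Neg (var: nat)

text \<open>Formulas are lists, so an empty clause is false, a CNF formula without clauses is true (and
  has size \<open>0\<close>), and a depth-3 formula without CNF formulas is false.\<close>

type_synonym clause = "literal list"
type_synonym cnf = "clause list"
type_synonym depth3 = "cnf list"

fun eval_literal :: "bool list \<Rightarrow> literal \<Rightarrow> bool" where
  "eval_literal x (Pos i) \<longleftrightarrow> x ! i"
| "eval_literal x (Neg i) \<longleftrightarrow> \<not> x ! i"

definition eval_clause :: "bool list \<Rightarrow> clause \<Rightarrow> bool" where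
  "eval_clause x c \<longleftrightarrow> (\<exists>l\<in>set c. eval_literal x l)"

definition eval_cnf :: "bool list \<Rightarrow> cnf \<Rightarrow> bool" where
  "eval_cnf x \<phi> \<longleftrightarrow> (\<forall>c\<in>set \<phi>. eval_clause x c)"

definition eval_depth3 :: "bool list \<Rightarrow> depth3 \<Rightarrow> bool" where
  "eval_depth3 x F \<longleftrightarrow> (\<exists>\<phi>\<in>set F. eval_cnf x \<phi>)"

definition depth3_size :: "depth3 \<Rightarrow> nat" where
  "depth3_size F = (\<Sum>\<phi>\<leftarrow>F. length \<phi>)"

definition depth3_over :: "nat \<Rightarrow> depth3 \<Rightarrow> bool" where
  "depth3_over n F \<longleftrightarrow> (\<forall>\<phi>\<in>set F. \<forall>c\<in>set \<phi>. \<forall>l\<in>set c. var l < n)"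

definition computes :: "nat \<Rightarrow> depth3 \<Rightarrow> (bool list \<Rightarrow> bool) \<Rightarrow> bool" where
  "computes n F f \<longleftrightarrow> depth3_over n F \<and> (\<forall>x. length x = n \<longrightarrow> eval_depth3 x F = f x)"

text \<open>The minimum is over a nonempty set, since every Boolean function is computed by a DNF formula,
  which is a depth-3 formula all of whose clauses are single literals.\<close>

definition L :: "nat \<Rightarrow> (bool list \<Rightarrow> bool) \<Rightarrow> nat" where
  "L n f = (LEAST s. \<exists>F. computes n F f \<and> depth3_size F = s)"

text \<open>Equality up to factors polylogarithmic in the comparison function \<open>g\<close>.\<close>

definition soft_theta :: "(nat \<Rightarrow> real) \<Rightarrow> (nat \<Rightarrow> real) set" where
  "soft_theta g = {f. \<exists>k::nat. f \<in> O(\<lambda>n. g n * ln (g n) ^ k) \<and> f \<in> \<Omega>(\<lambda>n. g n / ln (g n) ^ k)}"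

end

theory Submission
  imports Defs
begin

text \<open>Lower bound: if a CNF formula with \<open>m\<close> clauses implies parity, then flipping any variable \<open>i\<close>
  of a solution \<open>x\<close> falsifies some clause, of width \<open>k i\<close> say.  The solutions to which a given
  clause \<open>C\<close> is assigned in this way, for a given \<open>i\<close>, agree on the variables of \<open>C\<close>, and on the
  remaining variables the satisfiability coding lemma of Paturi, Pudlak and Zane applies.
  Summing over \<open>C\<close> and \<open>i\<close>, the terms \<open>2 powr (k i + (\<Sum>j\<notin>C. 1 / k j)) / k i\<close> add up to at most
  \<open>m * 2 ^ n\<close>, while for each solution their sum over \<open>i\<close> is at least
  \<open>2 powr (K + n / K - 2) \<ge> 2 powr (2 * sqrt n - 2)\<close>, where \<open>K\<close> is the mean of the \<open>k i\<close>.
  Upper bound: split the variables into about \<open>sqrt n\<close> blocks and guess the parity of each.\<close>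

section \<open>The satisfiability coding lemma\<close>

text \<open>Jensen's inequality for the convex function \<open>2 powr t\<close>, obtained by summing
  the tangent line at the mean \<open>b\<close>.\<close>

lemma card_mult_powr_mean_le:
  fixes a :: "'i \<Rightarrow> real"
  assumes "finite I" "I \<noteq> {}"
  shows "real (card I) * 2 powr (sum a I / real (card I)) \<le> (\<Sum>i\<in>I. 2 powr a i)"
proof -
  define b where "b = sum a I / real (card I)"
  have c: "real (card I) > 0" using assms by (simp add: card_gt_0_iff)
  have 1: "2 powr b * (1 + (a i - b) * ln 2) \<le> 2 powr a i" for i
  proof -
    have "1 + (a i - b) * ln 2 \<le> exp ((a i - b) * ln 2)" by (rule exp_ge_add_one_self)
    also have "\<dots> = 2 powr (a i - b)" by (simp add: powr_def)
    finally have "2 powr b * (1 + (a i - b) * ln 2) \<le> 2 powr b * 2 powr (a i - b)"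
      by (intro mult_left_mono) auto
    also have "\<dots> = 2 powr a i" by (simp flip: powr_add)
    finally show ?thesis .
  qed
  have "(\<Sum>i\<in>I. 2 powr b * (1 + (a i - b) * ln 2)) =
      2 powr b * (real (card I) + (sum a I - real (card I) * b) * ln 2)"
    by (simp add: sum.distrib sum_subtractf flip: sum_distrib_left sum_distrib_right)
  also have "\<dots> = real (card I) * 2 powr b"
    using c by (simp add: b_def)
  finally show ?thesis
    using sum_mono[of I "\<lambda>i. 2 powr b * (1 + (a i - b) * ln 2)" "\<lambda>i. 2 powr a i", OF 1]
    by (simp add: b_def)
qed

text \<open>The set \<open>A x j\<close> consists of the variables whose values force \<open>j\<close> to have its value in \<open>x\<close>.
  In a random order of \<open>V\<close>, the variable \<open>j\<close> comes after all of \<open>A x j\<close> with probability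
  \<open>1 / (card (A x j) + 1)\<close>, and then it need not be encoded.  The induction reveals the
  first variable of the order, so no permutations occur.\<close>

lemma satisfiability_coding:
  fixes val :: "'x \<Rightarrow> 'i \<Rightarrow> bool"
  assumes "finite V" "finite X"
    and "\<And>x y. x \<in> X \<Longrightarrow> y \<in> X \<Longrightarrow> (\<forall>j\<in>V. val x j = val y j) \<Longrightarrow> x = y"
    and "\<And>x j. x \<in> X \<Longrightarrow> j \<in> V \<Longrightarrow> A x j \<subseteq> V - {j}"
    and "\<And>x y j. x \<in> X \<Longrightarrow> y \<in> X \<Longrightarrow> j \<in> V \<Longrightarrow> (\<forall>l\<in>A x j. val x l = val y l) \<Longrightarrow> val x j = val y j"
  shows "(\<Sum>x\<in>X. 2 powr (\<Sum>j\<in>V. 1 / (real (card (A x j)) + 1))) \<le> 2 ^ card V"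
  using assms
proof (induction "card V" arbitrary: V X A)
  case 0
  have V: "V = {}" using "0.hyps" "0.prems"(1) by simp
  have "card X \<le> 1"
    using "0.prems"(3)[unfolded V] card_le_Suc0_iff_eq[OF "0.prems"(2)] by simp
  then show ?case by (simp add: V)
next
  case (Suc v)
  note fV = Suc.prems(1) and fX = Suc.prems(2) and dist = Suc.prems(3)
    and sub = Suc.prems(4) and force = Suc.prems(5)
  have Vne: "V \<noteq> {}" using Suc.hyps(2) by auto
  \<comment> \<open>The exponent of \<open>x\<close> once \<open>j\<close> is revealed first: 1 if
    \<open>j\<close> is forced by nothing at all, plus the exponent of the smaller instance in which
    \<open>j\<close> is deleted from every forcing set.\<close>
  define e where "e x j = (of_bool (A x j = {}) :: real)
    + (\<Sum>l\<in>V - {j}. 1 / (real (card (A x l - {j})) + 1))" for x j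
  have first: "(\<Sum>x\<in>X. 2 powr e x j) \<le> 2 ^ Suc v" if j: "j \<in> V" for j
  proof -
    define r where "r x = (\<Sum>l\<in>V - {j}. 1 / (real (card (A x l - {j})) + 1))" for x
    define Y where "Y b = {x \<in> X. val x j = b}" for b
    have half: "(\<Sum>x\<in>Y b. 2 powr r x) \<le> 2 ^ v" for b
    proof -
      have cv: "v = card (V - {j})" using Suc.hyps(2) j fV by simp
      have "(\<Sum>x\<in>Y b. 2 powr r x) \<le> 2 ^ card (V - {j})"
        unfolding r_def
      proof (rule Suc.hyps(1)[OF cv])
        show "finite (V - {j})" "finite (Y b)" using fV fX by (auto simp: Y_def)
        show "x = y" if "x \<in> Y b" "y \<in> Y b" "\<forall>j\<in>V - {j}. val x j = val y j" for x y
          using that dist[of x y] by (auto simp: Y_def)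
        show "A x l - {j} \<subseteq> V - {j} - {l}" if "x \<in> Y b" "l \<in> V - {j}" for x l
          using that sub[of x l] by (auto simp: Y_def)
        show "val x l = val y l" if "x \<in> Y b" "y \<in> Y b" "l \<in> V - {j}"
          "\<forall>l\<in>A x l - {j}. val x l = val y l" for x y l
          using that force[of x y l] by (auto simp: Y_def)
      qed
      then show ?thesis using cv by simp
    qed
    show ?thesis
    proof (cases "\<exists>x\<in>X. A x j = {}")
      \<comment> \<open>A solution that forces \<open>j\<close> from nothing makes \<open>j\<close>
        constant on \<open>X\<close>. One of the halves \<open>Y b\<close> is then empty, which pays
        for the extra factor 2 in \<open>e\<close>.\<close>
      case True
      then obtain x0 where x0: "x0 \<in> X" "A x0 j = {}" by blast
      have "val y j = val x0 j" if "y \<in> X" for y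
        using force[OF x0(1) that j] x0(2) by simp
      then have XY: "X = Y (val x0 j)" unfolding Y_def by blast
      have "(\<Sum>x\<in>X. 2 powr e x j) \<le> (\<Sum>x\<in>X. 2 * 2 powr r x)"
        by (intro sum_mono) (simp add: e_def r_def powr_add)
      also have "\<dots> = 2 * (\<Sum>x\<in>Y (val x0 j). 2 powr r x)"
        using XY by (simp flip: sum_distrib_left)
      also have "\<dots> \<le> 2 * 2 ^ v" using half by simp
      finally show ?thesis by simp
    next
      case False
      then have "(\<Sum>x\<in>X. 2 powr e x j) = (\<Sum>x\<in>X. 2 powr r x)"
        by (intro sum.cong) (auto simp: e_def r_def)
      also have "(\<Sum>x\<in>X. 2 powr r x)
          = (\<Sum>x\<in>Y True. 2 powr r x) + (\<Sum>x\<in>Y False. 2 powr r x)"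
      proof -
        have "X = Y True \<union> Y False" by (auto simp: Y_def)
        moreover have "Y True \<inter> Y False = {}" by (auto simp: Y_def)
        ultimately show ?thesis using fX by (metis finite_Un sum.union_disjoint)
      qed
      also have "\<dots> \<le> 2 ^ v + 2 ^ v" by (intro add_mono half)
      finally show ?thesis by simp
    qed
  qed
  have mean: "(\<Sum>j\<in>V. e x j) = real (Suc v) * (\<Sum>l\<in>V. 1 / (real (card (A x l)) + 1))"
    if x: "x \<in> X" for x
  proof -
    \<comment> \<open>With \<open>a = card (A x l)\<close>, the \<open>v - a\<close> choices of
      \<open>j\<close> outside \<open>A x l\<close> contribute \<open>1 / (a + 1)\<close> each. The
      \<open>a\<close> choices inside contribute \<open>1 / a\<close> each, hence 1 in total, and
      for \<open>a = 0\<close> the indicator supplies this 1.\<close>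
    have one: "of_bool (A x l = {}) + (\<Sum>j\<in>V - {l}. 1 / (real (card (A x l - {j})) + 1))
        = real (Suc v) * (1 / (real (card (A x l)) + 1))" if l: "l \<in> V" for l
    proof -
      define a where "a = card (A x l)"
      have AV: "A x l \<subseteq> V - {l}" using sub x l by blast
      have fA: "finite (A x l)" using AV fV finite_subset by blast
      have cV: "card (V - {l}) = v" using Suc.hyps(2) l fV by simp
      have av: "a \<le> v" using card_mono[OF _ AV] fV cV by (simp add: a_def)
      have "(\<Sum>j\<in>V - {l}. 1 / (real (card (A x l - {j})) + 1))
        = (\<Sum>j\<in>V - {l} - A x l. 1 / (real (card (A x l - {j})) + 1))
        + (\<Sum>j\<in>A x l. 1 / (real (card (A x l - {j})) + 1))"
        using AV fV by (intro sum.subset_diff) auto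
      also have "(\<Sum>j\<in>V - {l} - A x l. 1 / (real (card (A x l - {j})) + 1))
          = (\<Sum>j\<in>V - {l} - A x l. 1 / (real a + 1))"
        by (intro sum.cong) (auto simp: a_def)
      also have "\<dots> = (real v - real a) / (real a + 1)"
        using card_Diff_subset[OF fA AV] cV av by (simp add: a_def of_nat_diff)
      also have "(\<Sum>j\<in>A x l. 1 / (real (card (A x l - {j})) + 1)) = (\<Sum>j\<in>A x l. 1 / real a)"
      proof (intro sum.cong refl)
        fix j assume "j \<in> A x l"
        then have "Suc (card (A x l - {j})) = a" using fA card_Suc_Diff1 a_def by metis
        then have "real (card (A x l - {j})) + 1 = real a" by (metis of_nat_Suc add.commute)
        then show "1 / (real (card (A x l - {j})) + 1) = 1 / real a" by simp
      qed
      also have "\<dots> = of_bool (a \<noteq> 0)" by (simp add: a_def)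
      finally have "of_bool (A x l = {}) + (\<Sum>j\<in>V - {l}. 1 / (real (card (A x l - {j})) + 1))
        = of_bool (A x l = {}) + (real v - real a) / (real a + 1) + of_bool (a \<noteq> 0)" by simp
      also have "\<dots> = 1 + (real v - real a) / (real a + 1)" using fA by (simp add: a_def)
      also have "\<dots> = real (Suc v) * (1 / (real a + 1))" by (simp add: field_simps)
      finally show ?thesis by (simp add: a_def)
    qed
    have swap: "(\<Sum>j\<in>V. \<Sum>l\<in>V - {j}. f l j) = (\<Sum>l\<in>V. \<Sum>j\<in>V - {l}. f l j)"
      for f :: "'i \<Rightarrow> 'i \<Rightarrow> real"
    proof -
      have *: "(\<Sum>j\<in>V - {l}. g j) = (\<Sum>j\<in>V. if j = l then 0 else g j)" if "l \<in> V"
        for l and g :: "'i \<Rightarrow> real"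
        using fV that by (subst sum.remove[OF fV that]) (auto intro!: sum.cong)
      have "(\<Sum>j\<in>V. \<Sum>l\<in>V - {j}. f l j) = (\<Sum>j\<in>V. \<Sum>l\<in>V. if l = j then 0 else f l j)"
        by (intro sum.cong refl *)
      also have "\<dots> = (\<Sum>l\<in>V. \<Sum>j\<in>V. if l = j then 0 else f l j)" by (rule sum.swap)
      also have "\<dots> = (\<Sum>l\<in>V. \<Sum>j\<in>V. if j = l then 0 else f l j)"
        by (intro sum.cong refl) auto
      also have "\<dots> = (\<Sum>l\<in>V. \<Sum>j\<in>V - {l}. f l j)"
        by (intro sum.cong refl *[symmetric])
      finally show ?thesis .
    qed
    have "(\<Sum>j\<in>V. e x j) = (\<Sum>l\<in>V. of_bool (A x l = {})
        + (\<Sum>j\<in>V - {l}. 1 / (real (card (A x l - {j})) + 1)))"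
      unfolding e_def sum.distrib by (subst swap) simp
    also have "\<dots> = (\<Sum>l\<in>V. real (Suc v) * (1 / (real (card (A x l)) + 1)))"
      by (intro sum.cong refl one)
    finally show ?thesis by (simp only: sum_distrib_left)
  qed
  have cV: "card V = Suc v" using Suc.hyps(2) by simp
  \<comment> \<open>By \<open>mean\<close>, the exponent in the claim is the average of
    \<open>e x j\<close> over the first variable \<open>j\<close>, so convexity reduces the claim to
    the bound \<open>first\<close> for each \<open>j\<close>.\<close>
  have "real (Suc v) * (\<Sum>x\<in>X. 2 powr (\<Sum>j\<in>V. 1 / (real (card (A x j)) + 1)))
      = (\<Sum>x\<in>X. real (card V) * 2 powr ((\<Sum>j\<in>V. e x j) / real (card V)))"
    unfolding sum_distrib_left by (intro sum.cong refl) (simp add: mean cV)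
  also have "\<dots> \<le> (\<Sum>x\<in>X. \<Sum>j\<in>V. 2 powr e x j)"
    by (intro sum_mono card_mult_powr_mean_le fV Vne)
  also have "\<dots> = (\<Sum>j\<in>V. \<Sum>x\<in>X. 2 powr e x j)" by (rule sum.swap)
  also have "\<dots> \<le> (\<Sum>j\<in>V. 2 ^ Suc v)" by (intro sum_mono first)
  also have "\<dots> = real (Suc v) * 2 ^ card V" using cV by simp
  finally show ?case by (simp only: mult_le_cancel_left_pos of_nat_0_less_iff zero_less_Suc)
qed

section \<open>Critical clauses\<close>

definition flip :: "bool list \<Rightarrow> nat \<Rightarrow> bool list" where
  "flip x i = x[i := \<not> x ! i]"

lemma length_flip [simp]: "length (flip x i) = length x"
  by (simp add: flip_def)

lemma nth_flip: "i < length x \<Longrightarrow> flip x i ! j = (if i = j then \<not> x ! j else x ! j)"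
  by (auto simp: flip_def nth_list_update)

lemma flip_flip [simp]: "flip (flip x i) i = x"
  by (cases "i < length x") (simp_all add: flip_def list_update_beyond)

abbreviation clause_vars :: "clause \<Rightarrow> nat set" where
  "clause_vars c \<equiv> var ` set c"

text \<open>Critical clauses in the sense of Paturi, Pudlak and Zane: they witness that
  \<open>x\<close> is isolated in direction \<open>i\<close>.\<close>

definition critical :: "clause \<Rightarrow> bool list \<Rightarrow> nat \<Rightarrow> bool" where
  "critical c x i \<longleftrightarrow> eval_clause x c \<and> \<not> eval_clause (flip x i) c"

lemma eval_literal_cong: "x ! var l = y ! var l \<Longrightarrow> eval_literal x l = eval_literal y l"
  by (cases l) auto

lemma eval_clause_cong:
  "(\<And>v. v \<in> clause_vars c \<Longrightarrow> x ! v = y ! v) \<Longrightarrow> eval_clause x c = eval_clause y c"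
  unfolding eval_clause_def by (intro bex_cong refl eval_literal_cong) auto

text \<open>Falsifying a clause makes all its literals false, which determines the value of each of
  its variables.\<close>

lemma falsified_agree:
  assumes "\<not> eval_clause x c" "\<not> eval_clause y c" "v \<in> clause_vars c"
  shows "x ! v = y ! v"
proof -
  obtain l where l: "l \<in> set c" "v = var l" using assms(3) by auto
  then have "\<not> eval_literal x l" "\<not> eval_literal y l"
    using assms(1,2) by (auto simp: eval_clause_def)
  then show ?thesis using l(2) by (cases l) auto
qed

lemma critical_var:
  assumes "critical c x i" "i < length x"
  shows "i \<in> clause_vars c"
proof (rule ccontr)
  assume "i \<notin> clause_vars c"
  then have "eval_clause x c = eval_clause (flip x i) c"
    using assms(2) by (intro eval_clause_cong) (auto simp: nth_flip)
  then show False using assms(1) by (simp add: critical_def)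
qed

text \<open>If \<open>y\<close> differed from \<open>x\<close> at \<open>i\<close>, it would look
  like \<open>flip x i\<close> on the variables of \<open>c\<close> and falsify \<open>c\<close>.
  This supplies the forcing hypothesis of \<open>satisfiability_coding\<close>.\<close>

lemma critical_forces:
  assumes "critical c x i" "i < length x" "eval_clause y c"
    and "\<And>v. v \<in> clause_vars c - {i} \<Longrightarrow> x ! v = y ! v"
  shows "x ! i = y ! i"
proof (rule ccontr)
  assume "x ! i \<noteq> y ! i"
  then have "eval_clause (flip x i) c = eval_clause y c"
    using assms(2,4) by (intro eval_clause_cong) (auto simp: nth_flip)
  then show False using assms(1,3) by (simp add: critical_def)
qed

text \<open>Both flipped vectors falsify \<open>c\<close>, so they agree on its variables, and
  flipping the same position back keeps the agreement.\<close>

lemma critical_agree: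
  assumes "critical c x i" "critical c y i" "i < length x" "i < length y" "v \<in> clause_vars c"
  shows "x ! v = y ! v"
proof -
  have "flip x i ! v = flip y i ! v"
    using assms(1,2,5) by (intro falsified_agree) (auto simp: critical_def)
  then show ?thesis using assms(3,4) by (auto simp: nth_flip split: if_splits)
qed

section \<open>The number of isolated solutions\<close>

text \<open>The numerical core: \<open>B i\<close> stands for the variables of the critical clause
  at \<open>i\<close>, and \<open>k i\<close> for its width. Linearizing at the mean width
  \<open>K\<close> makes the exponents easy to average, and convexity then bounds the sum.\<close>

lemma sum_powr_width_ge:
  fixes k :: "nat \<Rightarrow> nat" and B :: "nat \<Rightarrow> nat set"
  assumes n: "n \<ge> 1"
    and B: "\<And>i. i < n \<Longrightarrow> B i \<subseteq> {..<n}" "\<And>i. i < n \<Longrightarrow> card (B i) = k i"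
    and k: "\<And>i. i < n \<Longrightarrow> k i \<ge> 1"
  shows "2 powr (2 * sqrt (real n) - 2)
    \<le> (\<Sum>i<n. 2 powr (real (k i) + (\<Sum>j\<in>{..<n} - B i. 1 / real (k j))) / real (k i))"
proof -
  define K where "K = (\<Sum>i<n. real (k i)) / real n"
  have n0: "real n > 0" using n by simp
  have kn: "k i \<le> n" if "i < n" for i
    using card_mono[OF _ B(1)[OF that]] B(2)[OF that] by simp
  have "(\<Sum>i<n. 1) \<le> (\<Sum>i<n. real (k i))"
    using k by (intro sum_mono) fastforce
  then have K1: "K \<ge> 1" using n0 by (simp add: K_def)
  have "(\<Sum>i<n. real (k i)) \<le> (\<Sum>i<n. real n)"
    using kn by (intro sum_mono) auto
  then have Kn: "K \<le> real n" using n0 by (simp add: K_def field_simps)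
  have sumk: "(\<Sum>i<n. real (k i)) = real n * K" using n0 by (simp add: K_def)
  \<comment> \<open>The tangent to \<open>1 / t\<close> at \<open>t = K\<close>, which lies below
    the convex graph.\<close>
  have tangent: "2 / K - t / K^2 \<le> 1 / t" if "t \<ge> 1" for t :: real
  proof -
    have "0 \<le> (t - K)^2 / (t * K^2)" using that by simp
    also have "\<dots> = 1 / t - (2 / K - t / K^2)"
      using that K1 by (simp add: field_simps power2_eq_square)
    finally show ?thesis by simp
  qed
  have Q: "real n / K - 2 * real (k i) / K \<le> (\<Sum>j\<in>{..<n} - B i. 1 / real (k j))" if i: "i < n" for i
  proof -
    have fB: "finite (B i)" using B(1)[OF i] finite_subset by blast
    have c: "real (card ({..<n} - B i)) = real n - real (k i)"
      using card_Diff_subset[OF fB B(1)[OF i]] B(2)[OF i] kn[OF i] by (simp add: of_nat_diff)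
    \<comment> \<open>The widths enter the tangent bound negatively, so their sum may be enlarged to
      all \<open>n\<close> variables. Excluding \<open>B i\<close> then costs only
      \<open>2 * k i / K\<close>.\<close>
    have "(\<Sum>j\<in>{..<n} - B i. real (k j)) \<le> real n * K"
      unfolding sumk[symmetric] by (intro sum_mono2) auto
    then have "(\<Sum>j\<in>{..<n} - B i. real (k j)) / K^2 \<le> real n / K"
      using K1 by (simp add: field_simps power2_eq_square)
    moreover have "real n / K - 2 * real (k i) / K
        = (real n - real (k i)) * (2 / K) - real n / K"
      by (simp add: left_diff_distrib diff_divide_distrib)
    ultimately have "real n / K - 2 * real (k i) / K
        \<le> (real n - real (k i)) * (2 / K) - (\<Sum>j\<in>{..<n} - B i. real (k j)) / K^2"
      by argo
    also have "\<dots> = (\<Sum>j\<in>{..<n} - B i. 2 / K - real (k j) / K^2)"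
      using c by (simp add: sum_subtractf sum_divide_distrib)
    also have "\<dots> \<le> (\<Sum>j\<in>{..<n} - B i. 1 / real (k j))"
      using k by (intro sum_mono tangent) auto
    finally show ?thesis .
  qed
  \<comment> \<open>The division by \<open>k i\<close> is moved into the exponent, so that convexity
    can be applied to whole terms.\<close>
  define u where "u i = log 2 (real (k i))" for i
  have ku: "real (k i) = 2 powr u i" if "i < n" for i
    using k[OF that] by (simp add: u_def)
  \<comment> \<open>The coefficient \<open>1 - 2 / K\<close> produces the loss 2 in the final
    exponent, since the \<open>k i\<close> have mean \<open>K\<close>.\<close>
  define a where "a i = real (k i) * (1 - 2 / K) + real n / K - u i" for i
  have ne: "{..<n} \<noteq> {}" using n lessThan_empty_iff by auto
  \<comment> \<open>Convexity applied to \<open>u\<close>: the geometric mean of the widths is at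
    most \<open>K\<close>.\<close>
  have "real n * 2 powr (sum u {..<n} / real n) \<le> (\<Sum>i<n. 2 powr u i)"
    using card_mult_powr_mean_le[of "{..<n}" u] ne by simp
  also have "\<dots> = real n * K" using ku sumk by simp
  finally have uK: "2 powr (sum u {..<n} / real n) \<le> K" using n0 by simp
  have KnK: "2 * sqrt (real n) \<le> K + real n / K"
  proof -
    have "0 \<le> (sqrt K - sqrt (real n / K))^2" by simp
    also have "\<dots> = K + real n / K - 2 * (sqrt K * sqrt (real n / K))"
      using K1 n0 by (simp add: power2_diff)
    also have "sqrt K * sqrt (real n / K) = sqrt (real n)"
      using K1 by (simp flip: real_sqrt_mult)
    finally show ?thesis by simp
  qed
  have "sum a {..<n} = real n * K * (1 - 2 / K) + real n * (real n / K) - sum u {..<n}"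
    unfolding a_def sumk[symmetric] by (simp add: sum.distrib sum_subtractf sum_distrib_right)
  then have am: "sum a {..<n} / real n = (K - 2 + real n / K) - sum u {..<n} / real n"
    using n0 K1 by (simp add: field_simps)
  have "2 powr (2 * sqrt (real n) - 2) \<le> 2 powr (K - 2 + real n / K)"
    using KnK by (intro powr_mono) auto
  \<comment> \<open>The number \<open>n\<close> of terms makes up for the division by the widths, as
    \<open>K\<close> is at most \<open>n\<close>.\<close>
  also have "\<dots> \<le> real n / K * 2 powr (K - 2 + real n / K)"
    using mult_right_mono[of 1 "real n / K" "2 powr (K - 2 + real n / K)"] Kn K1 by simp
  also have "\<dots> \<le> real n / 2 powr (sum u {..<n} / real n) * 2 powr (K - 2 + real n / K)"
    using uK n0 K1 by (intro mult_right_mono divide_left_mono) auto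
  also have "\<dots> = real n * 2 powr (sum a {..<n} / real n)"
    unfolding am powr_diff by simp
  also have "\<dots> \<le> (\<Sum>i<n. 2 powr a i)"
    using card_mult_powr_mean_le[of "{..<n}" a] ne by simp
  also have "\<dots> \<le> (\<Sum>i<n. 2 powr (real (k i) + (\<Sum>j\<in>{..<n} - B i. 1 / real (k j))) / real (k i))"
  proof (intro sum_mono)
    fix i assume "i \<in> {..<n}"
    then have i: "i < n" by simp
    have "2 powr a i = 2 powr (real (k i) * (1 - 2 / K) + real n / K) / real (k i)"
      by (simp add: a_def ku[OF i] powr_diff)
    also have "\<dots> \<le> 2 powr (real (k i) + (\<Sum>j\<in>{..<n} - B i. 1 / real (k j))) / real (k i)"
      using Q[OF i] by (intro divide_right_mono powr_mono) (auto simp: algebra_simps)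
    finally show "2 powr a i
      \<le> 2 powr (real (k i) + (\<Sum>j\<in>{..<n} - B i. 1 / real (k j))) / real (k i)" .
  qed
  finally show ?thesis .
qed

lemma finite_lists_length_eq_bool: "finite {x :: bool list. length x = n \<and> P x}"
  by (rule finite_subset[OF _ finite_lists_length_eq[of UNIV n]]) auto

text \<open>Double counting of the weights \<open>g x i\<close>: each solution receives at least
  \<open>2 powr (2 * sqrt n - 2)\<close>, and each clause accounts for at most
  \<open>2 ^ n\<close>.\<close>

lemma isolated_solutions_bound:
  assumes n: "n \<ge> 1"
    and over: "\<And>c. c \<in> set \<phi> \<Longrightarrow> clause_vars c \<subseteq> {..<n}"
    and X: "X = {x. length x = n \<and> eval_cnf x \<phi>}"
    and isol: "\<And>x i. x \<in> X \<Longrightarrow> i < n \<Longrightarrow> flip x i \<notin> X"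
  shows "real (card X) * 2 powr (2 * sqrt (real n) - 2) \<le> real (length \<phi>) * 2 ^ n"
proof -
  have fX: "finite X" unfolding X by (rule finite_lists_length_eq_bool)
  have "\<exists>c\<in>set \<phi>. critical c x i" if "x \<in> X" "i < n" for x i
    using that isol[OF that] by (auto simp: X eval_cnf_def critical_def)
  then obtain C where C: "\<And>x i. x \<in> X \<Longrightarrow> i < n \<Longrightarrow> C x i \<in> set \<phi>"
    and crit: "\<And>x i. x \<in> X \<Longrightarrow> i < n \<Longrightarrow> critical (C x i) x i" by metis
  define w where "w c = card (clause_vars c)" for c :: clause
  define g where "g x i = 2 powr (real (w (C x i))
      + (\<Sum>j\<in>{..<n} - clause_vars (C x i). 1 / real (w (C x j)))) / real (w (C x i))" for x i
  have Cvar: "i \<in> clause_vars (C x i)" if "x \<in> X" "i < n" for x i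
    using critical_var[OF crit[OF that]] that by (simp add: X)
  have w1: "w (C x i) \<ge> 1" if "x \<in> X" "i < n" for x i
    using Cvar[OF that] by (auto simp: w_def Suc_le_eq card_gt_0_iff)
  have lower: "2 powr (2 * sqrt (real n) - 2) \<le> (\<Sum>i<n. g x i)" if "x \<in> X" for x
    unfolding g_def
    by (rule sum_powr_width_ge[OF n]) (use that C over w1 in \<open>auto simp: w_def\<close>)
  have clause: "(\<Sum>x\<in>{x \<in> X. C x i = c}. g x i) \<le> 2 ^ n / real (w c)"
    if c: "c \<in> set \<phi>" and i: "i < n" for c i
  proof -
    define Y where "Y = {x \<in> X. C x i = c}"
    define V where "V = {..<n} - clause_vars c"
    \<comment> \<open>On \<open>Y\<close> the variables of \<open>c\<close> are constant, so only
      the variables of \<open>C x j\<close> outside \<open>c\<close> are needed to force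
      \<open>j\<close>.\<close>
    define A where "A x j = clause_vars (C x j) \<inter> V - {j}" for x j
    have YX: "x \<in> X" "critical c x i" "length x = n" "eval_cnf x \<phi>" if "x \<in> Y" for x
      using that crit[of x i] i by (auto simp: Y_def X)
    have agree: "x ! v = y ! v" if "x \<in> Y" "y \<in> Y" "v \<in> clause_vars c" for x y v
      using critical_agree[OF YX(2)[OF that(1)] YX(2)[OF that(2)]] YX(3) that i by auto
    have "(\<Sum>x\<in>Y. 2 powr (\<Sum>j\<in>V. 1 / (real (card (A x j)) + 1))) \<le> 2 ^ card V"
    proof (rule satisfiability_coding[where val = "\<lambda>x j. x ! j"])
      show "finite V" "finite Y" using fX by (auto simp: V_def Y_def)
      show "x = y" if "x \<in> Y" "y \<in> Y" "\<forall>j\<in>V. x ! j = y ! j" for x y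
        using that agree[OF that(1,2)] YX(3)
        by (intro nth_equalityI) (auto simp: V_def)
      show "A x j \<subseteq> V - {j}" for x j by (auto simp: A_def)
      show "x ! j = y ! j" if "x \<in> Y" "y \<in> Y" "j \<in> V" "\<forall>l\<in>A x j. x ! l = y ! l" for x y j
      proof (rule critical_forces)
        have j: "j < n" using that(3) by (simp add: V_def)
        show "critical (C x j) x j" using crit YX(1) that(1) j by blast
        show "j < length x" using j YX(3) that(1) by simp
        show "eval_clause y (C x j)"
          using YX(4)[OF that(2)] C[OF YX(1)[OF that(1)] j] by (simp add: eval_cnf_def)
        show "x ! v = y ! v" if "v \<in> clause_vars (C x j) - {j}" for v
          using that \<open>\<forall>l\<in>A x j. x ! l = y ! l\<close> agree[OF \<open>x \<in> Y\<close> \<open>y \<in> Y\<close>, of v]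
            over[OF C[OF YX(1)[OF \<open>x \<in> Y\<close>] j]]
          by (cases "v \<in> clause_vars c") (auto simp: A_def V_def)
      qed
    qed
    \<comment> \<open>Each critical clause contains \<open>j\<close> itself, so \<open>A x j\<close>
      has at most \<open>w (C x j) - 1\<close> elements.\<close>
    moreover have "2 powr (\<Sum>j\<in>V. 1 / real (w (C x j)))
        \<le> 2 powr (\<Sum>j\<in>V. 1 / (real (card (A x j)) + 1))" if "x \<in> Y" for x
    proof (intro powr_mono sum_mono)
      fix j assume "j \<in> V"
      then have j: "j < n" by (simp add: V_def)
      have "card (A x j) \<le> card (clause_vars (C x j) - {j})"
        by (intro card_mono) (auto simp: A_def)
      also have "Suc \<dots> = w (C x j)"
        using card_Suc_Diff1[OF _ Cvar[OF YX(1)[OF that] j]] by (simp add: w_def)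
      finally have "real (card (A x j)) + 1 \<le> real (w (C x j))" by linarith
      then show "1 / real (w (C x j)) \<le> 1 / (real (card (A x j)) + 1)"
        by (intro divide_left_mono mult_pos_pos) auto
    qed simp
    ultimately have "(\<Sum>x\<in>Y. 2 powr (\<Sum>j\<in>V. 1 / real (w (C x j)))) \<le> 2 ^ card V"
      by (meson order_trans sum_mono)
    then have "2 powr real (w c) / real (w c) * (\<Sum>x\<in>Y. 2 powr (\<Sum>j\<in>V. 1 / real (w (C x j))))
        \<le> 2 powr real (w c) / real (w c) * 2 ^ card V"
      by (intro mult_left_mono) auto
    moreover have "(\<Sum>x\<in>Y. g x i)
        = 2 powr real (w c) / real (w c) * (\<Sum>x\<in>Y. 2 powr (\<Sum>j\<in>V. 1 / real (w (C x j))))"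
      unfolding sum_distrib_left g_def
      by (intro sum.cong) (auto simp: Y_def V_def powr_add)
    \<comment> \<open>The factor \<open>2 powr w c\<close> in the weight makes up exactly for the
      variables of \<open>c\<close> missing from \<open>V\<close>.\<close>
    moreover have "w c + card V = n"
    proof -
      have "card V = n - w c"
        using card_Diff_subset[OF _ over[OF c]] by (simp add: V_def w_def)
      moreover have "w c \<le> n" using card_mono[OF _ over[OF c]] by (simp add: w_def)
      ultimately show ?thesis by simp
    qed
    then have "2 powr real (w c) * 2 ^ card V = (2 :: real) ^ n"
      by (simp add: powr_realpow flip: power_add)
    ultimately show ?thesis by (simp add: Y_def)
  qed
  have "real (card X) * 2 powr (2 * sqrt (real n) - 2)
      \<le> (\<Sum>x\<in>X. \<Sum>i<n. g x i)"
    using sum_mono[of X, OF lower] by simp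
  also have "\<dots> = (\<Sum>i<n. \<Sum>x\<in>X. g x i)" by (rule sum.swap)
  \<comment> \<open>Solutions are grouped by their critical clause at \<open>i\<close>, which
    contains the variable \<open>i\<close>.\<close>
  also have "\<dots> = (\<Sum>i<n. \<Sum>c\<in>{c \<in> set \<phi>. i \<in> clause_vars c}. \<Sum>x\<in>{x \<in> X. C x i = c}. g x i)"
    by (intro sum.cong refl sum.group[symmetric]) (use fX C Cvar in auto)
  also have "\<dots> \<le> (\<Sum>i<n. \<Sum>c\<in>{c \<in> set \<phi>. i \<in> clause_vars c}. 2 ^ n / real (w c))"
    by (intro sum_mono clause) auto
  also have "\<dots> = (\<Sum>i<n. \<Sum>c\<in>set \<phi>. if i \<in> clause_vars c then 2 ^ n / real (w c) else 0)"
    by (intro sum.cong refl sum.inter_filter) auto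
  also have "\<dots> = (\<Sum>c\<in>set \<phi>. \<Sum>i<n. if i \<in> clause_vars c then 2 ^ n / real (w c) else 0)"
    by (rule sum.swap)
  also have "\<dots> \<le> (\<Sum>c\<in>set \<phi>. 2 ^ n)"
  proof (intro sum_mono)
    fix c assume c: "c \<in> set \<phi>"
    have "(\<Sum>i<n. if i \<in> clause_vars c then 2 ^ n / real (w c) else 0)
        = (\<Sum>i\<in>clause_vars c. 2 ^ n / real (w c))"
      using over[OF c] by (simp add: sum.inter_restrict[symmetric] Int_absorb1)
    \<comment> \<open>There are \<open>w c\<close> equal summands. For the empty clause the sum is
      empty.\<close>
    also have "\<dots> \<le> 2 ^ n" by (simp flip: w_def)
    finally show "(\<Sum>i<n. if i \<in> clause_vars c then 2 ^ n / real (w c) else 0) \<le> (2 ^ n :: real)" .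
  qed
  also have "\<dots> \<le> real (length \<phi>) * 2 ^ n"
    using card_length[of \<phi>] by simp
  finally show ?thesis .
qed

section \<open>Parity\<close>

text \<open>Variables are listed rather than collected in a set, so that concatenating blocks
  becomes exclusive or.\<close>

definition odd_on :: "bool list \<Rightarrow> nat list \<Rightarrow> bool" where
  "odd_on x vs \<longleftrightarrow> odd (length (filter ((!) x) vs))"

lemma odd_on_Nil [simp]: "\<not> odd_on x []"
  by (simp add: odd_on_def)

lemma odd_on_Cons [simp]: "odd_on x (v # vs) \<longleftrightarrow> x ! v \<noteq> odd_on x vs"
  by (simp add: odd_on_def)

lemma odd_on_append [simp]: "odd_on x (us @ vs) \<longleftrightarrow> odd_on x us \<noteq> odd_on x vs"
  by (simp add: odd_on_def)

lemma parity_eq_odd_on: "length x = n \<Longrightarrow> parity x \<longleftrightarrow> odd_on x [0..<n]"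
proof -
  assume "length x = n"
  then have "{i. i < length x \<and> x ! i} = set (filter ((!) x) [0..<n])" by auto
  then show ?thesis
    unfolding parity_def odd_on_def by (simp only: distinct_card distinct_filter distinct_upt)
qed

lemma parity_flip:
  assumes "i < length x"
  shows "parity (flip x i) \<longleftrightarrow> \<not> parity x"
proof -
  \<comment> \<open>Only a change from false to true is counted; the other direction follows because
    \<open>flip\<close> is an involution.\<close>
  have *: "parity (flip y i) \<longleftrightarrow> \<not> parity y" if "i < length y" "\<not> y ! i" for y
  proof -
    have "{j. j < length (flip y i) \<and> flip y i ! j} = insert i {j. j < length y \<and> y ! j}"
      using that by (auto simp: nth_flip split: if_splits)
    then show ?thesis using that by (simp add: parity_def)
  qed
  show ?thesis
    using *[of x] *[of "flip x i"] assms by (cases "x ! i") (auto simp: nth_flip)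
qed

text \<open>Every vector is odd or becomes odd when variable 0 is flipped; \<open>n \<ge> 1\<close>
  provides this variable.\<close>

lemma card_parity_ge:
  assumes "n \<ge> 1"
  shows "2 ^ n \<le> 2 * card {x. length x = n \<and> parity x}"
proof -
  let ?O = "{x. length x = n \<and> parity x}"
  have "{x :: bool list. length x = n} \<subseteq> ?O \<union> (\<lambda>x. flip x 0) ` ?O"
  proof
    fix x :: "bool list" assume "x \<in> {x. length x = n}"
    then have "x \<in> ?O \<or> flip x 0 \<in> ?O" using assms parity_flip[of 0 x] by auto
    then show "x \<in> ?O \<union> (\<lambda>x. flip x 0) ` ?O"
      using image_eqI[of x "\<lambda>x. flip x 0" "flip x 0" ?O] by auto
  qed
  then have "card {x :: bool list. length x = n} \<le> card (?O \<union> (\<lambda>x. flip x 0) ` ?O)"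
    by (intro card_mono) (auto intro: finite_lists_length_eq_bool)
  also have "\<dots> \<le> card ?O + card ((\<lambda>x. flip x 0) ` ?O)" by (rule card_Un_le)
  also have "\<dots> \<le> card ?O + card ?O"
    by (intro add_left_mono card_image_le finite_lists_length_eq_bool)
  finally show ?thesis
    using card_lists_length_eq[of "UNIV :: bool set" n] by simp
qed

text \<open>Solutions of each CNF in \<open>F\<close> are odd, hence isolated, and together they
  cover at least half of the cube. This half lowers the exponent by one more, from
  \<open>- 2\<close> to \<open>- 3\<close>.\<close>

lemma parity_depth3_size_ge:
  assumes n: "n \<ge> 1" and F: "computes n F parity"
  shows "2 powr (2 * sqrt (real n) - 3) \<le> real (depth3_size F)"
proof -
  define S where "S \<phi> = {x. length x = n \<and> eval_cnf x \<phi>}" for \<phi>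
  define p where "p = 2 powr (2 * sqrt (real n) - 2)"
  have bound: "real (card (S \<phi>)) * p \<le> real (length \<phi>) * 2 ^ n" if \<phi>: "\<phi> \<in> set F" for \<phi>
    unfolding p_def
  proof (rule isolated_solutions_bound[OF n _ S_def])
    show "clause_vars c \<subseteq> {..<n}" if "c \<in> set \<phi>" for c
      using F \<phi> that by (auto simp: computes_def depth3_over_def)
    have par: "parity x" if "x \<in> S \<phi>" for x
      using F \<phi> that by (auto simp: computes_def eval_depth3_def S_def)
    show "flip x i \<notin> S \<phi>" if "x \<in> S \<phi>" "i < n" for x i
      using par[of x] par[of "flip x i"] that parity_flip[of i x] by (auto simp: S_def)
  qed
  have "{x. length x = n \<and> parity x} = (\<Union>\<phi>\<in>set F. S \<phi>)"
    using F by (auto simp: computes_def eval_depth3_def S_def)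
  then have "card {x. length x = n \<and> parity x} \<le> (\<Sum>\<phi>\<in>set F. card (S \<phi>))"
    using card_UN_le[of "set F" S] by simp
  then have "2 ^ n \<le> 2 * (\<Sum>\<phi>\<in>set F. card (S \<phi>))"
    using card_parity_ge[OF n] by linarith
  then have "real (2 ^ n) \<le> real (2 * (\<Sum>\<phi>\<in>set F. card (S \<phi>)))" by (rule of_nat_mono)
  then have "2 ^ n \<le> 2 * (\<Sum>\<phi>\<in>set F. real (card (S \<phi>)))" by simp
  then have "2 ^ n * p \<le> 2 * (\<Sum>\<phi>\<in>set F. real (card (S \<phi>))) * p"
    by (intro mult_right_mono) (auto simp: p_def)
  also have "\<dots> = 2 * (\<Sum>\<phi>\<in>set F. real (card (S \<phi>)) * p)"
    by (simp add: sum_distrib_right)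
  also have "\<dots> \<le> 2 * (\<Sum>\<phi>\<in>set F. real (length \<phi>) * 2 ^ n)"
    using bound by (intro mult_left_mono sum_mono) auto
  also have "\<dots> = 2 ^ n * (2 * real (\<Sum>\<phi>\<in>set F. length \<phi>))"
    by (simp add: sum_distrib_left mult.commute mult.left_commute)
  also have "\<dots> \<le> 2 ^ n * (2 * real (depth3_size F))"
  proof -
    \<comment> \<open>Repeated CNF formulas count once in \<open>set F\<close> but every time in the
      size.\<close>
    have "(\<Sum>\<phi>\<in>set F. length \<phi>) \<le> (\<Sum>\<phi>\<leftarrow>F. length \<phi>)"
      by (induction F) (simp_all add: sum.insert_if)
    then show ?thesis by (simp add: depth3_size_def del: of_nat_sum)
  qed
  finally have "p \<le> 2 * real (depth3_size F)" by simp
  moreover have "p = 2 * 2 powr (2 * sqrt (real n) - 3)"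
    by (simp add: p_def powr_diff)
  ultimately show ?thesis by simp
qed

section \<open>Upper bound: the block construction\<close>

text \<open>Branching on \<open>v\<close>: a clause starting with \<open>Pos v\<close> constrains
  the rest only when \<open>v\<close> is false, and dually for \<open>Neg v\<close>. In the base
  case, \<open>[[]]\<close> is the false CNF and \<open>[]\<close> the true one.\<close>

fun parity_cnf :: "nat list \<Rightarrow> bool \<Rightarrow> cnf" where
  "parity_cnf [] b = (if b then [[]] else [])"
| "parity_cnf (v # vs) b =
    map (Cons (Pos v)) (parity_cnf vs b) @ map (Cons (Neg v)) (parity_cnf vs (\<not> b))"

text \<open>One CNF for each guess of the block parities with total parity \<open>b\<close>, namely
  the concatenation of the CNFs checking the single blocks. In the base case, \<open>[]\<close> is
  false and \<open>[[]]\<close> true.\<close>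

fun parity_depth3 :: "nat list list \<Rightarrow> bool \<Rightarrow> depth3" where
  "parity_depth3 [] b = (if b then [] else [[]])"
| "parity_depth3 (vs # bs) b =
    map ((@) (parity_cnf vs True)) (parity_depth3 bs (\<not> b))
    @ map ((@) (parity_cnf vs False)) (parity_depth3 bs b)"

lemma eval_clause_Cons [simp]:
  "eval_clause x (l # c) \<longleftrightarrow> eval_literal x l \<or> eval_clause x c"
  by (auto simp: eval_clause_def)

lemma eval_parity_cnf: "eval_cnf x (parity_cnf vs b) \<longleftrightarrow> odd_on x vs = b"
proof (induction vs arbitrary: b)
  case Nil
  then show ?case by (simp add: eval_cnf_def eval_clause_def)
next
  case (Cons v vs)
  have "eval_cnf x (parity_cnf (v # vs) b) \<longleftrightarrow>
      (x ! v \<or> eval_cnf x (parity_cnf vs b)) \<and> (\<not> x ! v \<or> eval_cnf x (parity_cnf vs (\<not> b)))"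
    by (simp add: eval_cnf_def ball_Un)
  then show ?case by (auto simp: Cons.IH)
qed

lemma length_parity_cnf: "length (parity_cnf vs b) \<le> 2 ^ length vs"
proof (induction vs arbitrary: b)
  case (Cons v vs)
  show ?case using Cons.IH[of b] Cons.IH[of "\<not> b"] by simp
qed simp

lemma parity_cnf_vars: "c \<in> set (parity_cnf vs b) \<Longrightarrow> clause_vars c \<subseteq> set vs"
proof (induction vs arbitrary: b c)
  case (Cons v vs)
  then show ?case by fastforce
qed (auto split: if_splits)

lemma eval_parity_depth3: "eval_depth3 x (parity_depth3 bs b) \<longleftrightarrow> odd_on x (concat bs) = b"
proof (induction bs arbitrary: b)
  case Nil
  then show ?case by (simp add: eval_depth3_def eval_cnf_def)
next
  case (Cons vs bs)
  have "eval_depth3 x (parity_depth3 (vs # bs) b) \<longleftrightarrow>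
      (eval_cnf x (parity_cnf vs True) \<and> eval_depth3 x (parity_depth3 bs (\<not> b)))
      \<or> (eval_cnf x (parity_cnf vs False) \<and> eval_depth3 x (parity_depth3 bs b))"
    by (simp add: eval_depth3_def eval_cnf_def bex_Un ball_Un)
  then show ?case by (auto simp: Cons.IH eval_parity_cnf)
qed

lemma length_parity_depth3: "length (parity_depth3 bs b) \<le> 2 ^ length bs"
proof (induction bs arbitrary: b)
  case (Cons vs bs)
  show ?case using Cons.IH[of b] Cons.IH[of "\<not> b"] by simp
qed simp

text \<open>Each CNF is assembled from one \<open>parity_cnf\<close> per block, of at most
  \<open>2 ^ s\<close> clauses.\<close>

lemma length_in_parity_depth3:
  "\<phi> \<in> set (parity_depth3 bs b) \<Longrightarrow> (\<And>vs. vs \<in> set bs \<Longrightarrow> length vs \<le> s)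
    \<Longrightarrow> length \<phi> \<le> length bs * 2 ^ s"
proof (induction bs arbitrary: b \<phi>)
  case (Cons vs bs)
  then obtain b' b'' \<psi> where \<phi>: "\<phi> = parity_cnf vs b' @ \<psi>" and \<psi>: "\<psi> \<in> set (parity_depth3 bs b'')"
    by auto
  have "length (parity_cnf vs b') \<le> 2 ^ length vs" by (rule length_parity_cnf)
  also have "\<dots> \<le> 2 ^ s" using Cons.prems(2)[of vs] by simp
  finally have "length (parity_cnf vs b') \<le> 2 ^ s" .
  moreover have "length \<psi> \<le> length bs * 2 ^ s" using Cons.IH[OF \<psi>] Cons.prems(2) by simp
  ultimately show ?case using \<phi> by simp
qed (auto split: if_splits)

lemma depth3_size_parity_depth3:
  assumes "\<And>vs. vs \<in> set bs \<Longrightarrow> length vs \<le> s"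
  shows "depth3_size (parity_depth3 bs b) \<le> 2 ^ length bs * (length bs * 2 ^ s)"
proof -
  have "depth3_size (parity_depth3 bs b) \<le> (\<Sum>\<phi>\<leftarrow>parity_depth3 bs b. length bs * 2 ^ s)"
    unfolding depth3_size_def by (intro sum_list_mono length_in_parity_depth3 assms)
  also have "\<dots> = length (parity_depth3 bs b) * (length bs * 2 ^ s)"
    by (simp add: sum_list_triv)
  also have "\<dots> \<le> 2 ^ length bs * (length bs * 2 ^ s)"
    by (intro mult_right_mono length_parity_depth3) simp
  finally show ?thesis .
qed

lemma parity_depth3_vars:
  "\<phi> \<in> set (parity_depth3 bs b) \<Longrightarrow> c \<in> set \<phi> \<Longrightarrow> clause_vars c \<subseteq> set (concat bs)"
proof (induction bs arbitrary: b \<phi>)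
  case (Cons vs bs)
  then obtain b' b'' \<psi> where "\<phi> = parity_cnf vs b' @ \<psi>" and \<psi>: "\<psi> \<in> set (parity_depth3 bs b'')"
    by auto
  then have "c \<in> set (parity_cnf vs b') \<or> c \<in> set \<psi>" using Cons.prems(2) by auto
  then show ?case using parity_cnf_vars[of c vs b'] Cons.IH[OF \<psi>] by auto
qed (auto split: if_splits)

text \<open>Blocks of \<open>s\<close> variables are cut off the front; the last ones may be shorter
  or empty, so that there are exactly \<open>k\<close>.\<close>

lemma ex_blocks:
  "length vs \<le> k * s \<Longrightarrow>
    \<exists>bs. concat bs = vs \<and> length bs = k \<and> (\<forall>b\<in>set bs. length b \<le> s)"
proof (induction k arbitrary: vs)
  case (Suc k)
  then have "length (drop s vs) \<le> k * s" by simp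
  from Suc.IH[OF this] obtain bs where "concat bs = drop s vs" "length bs = k"
    "\<forall>b\<in>set bs. length b \<le> s" by blast
  then show ?case by (intro exI[of _ "take s vs # bs"]) auto
qed simp

lemma ex_parity_depth3:
  "\<exists>F. computes n F parity \<and>
    real (depth3_size F) \<le> (sqrt (real n) + 1) * 2 powr (2 * sqrt (real n) + 2)"
proof -
  \<comment> \<open>Using \<open>k\<close> blocks of length at most \<open>k\<close> balances the
    \<open>2 ^ k\<close> guesses against the \<open>2 ^ k\<close> clauses per block. Rounding up
    costs the \<open>+ 1\<close> and the \<open>+ 2\<close> in the bound.\<close>
  define k where "k = nat \<lceil>sqrt (real n)\<rceil>"
  have k: "sqrt (real n) \<le> real k" "real k \<le> sqrt (real n) + 1"
    unfolding k_def by (simp_all add: real_nat_ceiling_ge)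
  have "real n = sqrt (real n) * sqrt (real n)" by simp
  also have "\<dots> \<le> real k * real k" using k by (intro mult_mono) auto
  finally have "length [0..<n] \<le> k * k" by (simp flip: of_nat_mult)
  from ex_blocks[OF this] obtain bs where bs: "concat bs = [0..<n]" "length bs = k"
    "\<And>b. b \<in> set bs \<Longrightarrow> length b \<le> k" by blast
  let ?F = "parity_depth3 bs True"
  have "computes n ?F parity"
    unfolding computes_def depth3_over_def
    using parity_depth3_vars[of _ bs True] eval_parity_depth3[of _ bs True]
    by (fastforce simp: bs(1) parity_eq_odd_on)
  moreover have "real (depth3_size ?F) \<le> (sqrt (real n) + 1) * 2 powr (2 * sqrt (real n) + 2)"
  proof -
    have "depth3_size ?F \<le> 2 ^ k * (k * 2 ^ k)"
      using depth3_size_parity_depth3[of bs k True] bs by simp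
    then have "real (depth3_size ?F) \<le> real (2 ^ k * (k * 2 ^ k))" by (rule of_nat_mono)
    also have "\<dots> = real k * 2 powr (2 * real k)"
      using powr_add[of 2 "real k" "real k"] powr_realpow[of 2 k] by simp
    also have "\<dots> \<le> (sqrt (real n) + 1) * 2 powr (2 * sqrt (real n) + 2)"
      using k by (intro mult_mono powr_mono) auto
    finally show ?thesis .
  qed
  ultimately show ?thesis by blast
qed

section \<open>Bounds for the minimum size\<close>

lemma L_le: "computes n F f \<Longrightarrow> L n f \<le> depth3_size F"
  unfolding L_def by (rule Least_le) blast

lemma L_attained:
  assumes "computes n F f"
  shows "\<exists>G. computes n G f \<and> depth3_size G = L n f"
  unfolding L_def by (rule LeastI_ex) (use assms in blast)

lemma L_parity_ge:
  assumes "n \<ge> 1"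
  shows "2 powr (2 * sqrt (real n) - 5) \<le> real (L n parity)"
proof -
  obtain F where F: "computes n F parity" "depth3_size F = L n parity"
    using ex_parity_depth3[of n] L_attained by blast
  have "2 powr (2 * sqrt (real n) - 5) \<le> 2 powr (2 * sqrt (real n) - 3)"
    by (intro powr_mono) auto
  also have "\<dots> \<le> real (L n parity)"
    using parity_depth3_size_ge[OF assms F(1)] F(2) by simp
  finally show ?thesis .
qed

lemma L_parity_le:
  assumes "n \<ge> 1"
  shows "real (L n parity) \<le> 8 * (2 powr (2 * sqrt (real n)) * sqrt (real n))"
proof -
  obtain F where F: "computes n F parity"
    "real (depth3_size F) \<le> (sqrt (real n) + 1) * 2 powr (2 * sqrt (real n) + 2)"
    using ex_parity_depth3[of n] by blast
  have "real (L n parity) \<le> (sqrt (real n) + 1) * 2 powr (2 * sqrt (real n) + 2)"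
    using L_le[OF F(1)] F(2) by linarith
  \<comment> \<open>Here \<open>1 \<le> sqrt n\<close>; the constant 8 is this 2 times
    \<open>2 powr 2\<close>.\<close>
  also have "\<dots> \<le> (2 * sqrt (real n)) * 2 powr (2 * sqrt (real n) + 2)"
    using assms by (intro mult_right_mono) auto
  also have "\<dots> = 8 * (2 powr (2 * sqrt (real n)) * sqrt (real n))"
    by (simp add: powr_add)
  finally show ?thesis .
qed

text \<open>The explicit bounds start at \<open>n = 1\<close>: for \<open>n = 0\<close> the empty
  formula computes parity, so \<open>L\<close> is 0 and the lower bound fails. Since
  \<open>ln (g n)\<close> is \<open>2 * ln 2 * sqrt n\<close>, the power 1 of the logarithm
  suffices.\<close>

theorem theorem6p4:
  shows "(\<lambda>n. real (L n parity)) \<in> soft_theta (\<lambda>n. 2 powr (2 * sqrt (real n)))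
    \<and> (\<forall>n\<ge>1. 2 powr (2 * sqrt (real n) - 5) \<le> real (L n parity))
    \<and> (\<exists>C::real. \<forall>n\<ge>1. real (L n parity) \<le> C * (2 powr (2 * sqrt (real n)) * sqrt (real n)))"
proof -
  define g where "g n = 2 powr (2 * sqrt (real n))" for n :: nat
  have ln_g: "ln (g n) = 2 * ln 2 * sqrt (real n)" for n by (simp add: g_def ln_powr)
  have "(\<lambda>n. real (L n parity)) \<in> O(\<lambda>n. g n * ln (g n) ^ 1)"
  \<comment> \<open>The 8 of \<open>L_parity_le\<close> divided by the factor
    \<open>2 * ln 2\<close> of \<open>ln (g n)\<close>.\<close>
  proof (rule bigoI[where c = "4 / ln 2"], rule eventually_mono[OF eventually_ge_at_top[of 1]])
    fix n :: nat assume "n \<ge> 1"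
    then show "norm (real (L n parity)) \<le> 4 / ln 2 * norm (g n * ln (g n) ^ 1)"
      using L_parity_le[of n] by (simp add: ln_g abs_mult) (simp add: g_def)
  qed
  moreover have "(\<lambda>n. g n / ln (g n) ^ 1) \<in> O(\<lambda>n. real (L n parity))"
  \<comment> \<open>The factor \<open>2 ^ 5\<close> from the exponent \<open>- 5\<close>, divided by
    \<open>2 * ln 2\<close>, a lower bound for \<open>ln (g n)\<close>.\<close>
  proof (rule bigoI[where c = "16 / ln 2"], rule eventually_mono[OF eventually_ge_at_top[of 1]])
    fix n :: nat assume n: "n \<ge> 1"
    have "g n / ln (g n) \<le> g n / (2 * ln 2)"
      using n unfolding ln_g by (intro divide_left_mono) (auto simp: g_def)
    also have "\<dots> = 16 / ln 2 * 2 powr (2 * sqrt (real n) - 5)"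
      by (simp add: g_def powr_diff)
    also have "\<dots> \<le> 16 / ln 2 * real (L n parity)"
      using L_parity_ge[OF n] by (intro mult_left_mono) auto
    finally show "norm (g n / ln (g n) ^ 1) \<le> 16 / ln 2 * norm (real (L n parity))"
      by (simp add: ln_g abs_mult) (simp add: g_def)
  qed
  ultimately have "(\<lambda>n. real (L n parity)) \<in> soft_theta g"
    unfolding soft_theta_def bigomega_iff_bigo[symmetric] by blast
  then show ?thesis using L_parity_ge L_parity_le unfolding g_def by blast
qed

end
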